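(* The optimal arrival rate policy $\vec{\lambda}^*=(\lambda_0^*,\ldots,\lambda_N^* )$ has a uni-modal structure; that is, there exists an integer $\hat n\in\{0,\ldots,N-1\}$ such that $\lambda_n^*\le \lambda_{n+1}^*$ for $0\le n<\hat n$ and $\lambda_n^*\ge\lambda_{n+1}^*$ for $\hat n\le n<N$.
   Context: Model: a Markovian queue with $m$ servers, capacity $N$, maximal arrival rate $\Lambda$, service rate $\mu$, abandonment rates $\theta_s$ (in service) and $\theta_q$ (waiting), holding cost $c_h$, abandonment costs $c_s$ (in service) and $c_q$ (waiting). The parameters are integers $1\le m\le N<\infty$ and reals $\Lambda>0$, $\mu>0$, $\theta_q>0$, $\theta_s\ge 0$, $c_h,c_q,c_s\ge 0$, $0\le a<b<\infty$. $F$ is a continuous cumulative distribution function supported on $[a,b]$ ($F(a)=0$, $F(b)=1$) with a positive density on $[a,b]$; $\bar F=1-F$, and for $y\in[0,1]$, $\bar F^{-1}(y)=\inf\{x\in[a,b]:\bar F(x)\le y\}$. Death rates: $\gamma_n=\min\{n,m\}(\mu+\theta_s)+\max\{n-m,0\}\theta_q$. The time unit is scaled so that $\Lambda+m(\mu+\theta_s)+(N-m)\theta_q=1$. Markov decision process: states $\{0,\ldots,N\}$; actions $A_n=[0,\Lambda]$ for $n<N$ and $A_N=\{0\}$; rewards $$r_n(\lambda)=\lambda\bar F^{-1}(\lambda/\Lambda)-nc_h-\min\{n,m\}c_s\theta_s-\max\{n-m,0\}c_q\theta_q ;$$ transition probabilities $\mathbf P(n+1|n,\lambda)=\lambda$ for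 $n\le N-1$, $\mathbf P(n-1|n,\lambda)=\gamma_n$ for $n\ge1$, $\mathbf P(n|n,\lambda)=1-\lambda-\gamma_n$, and $0$ otherwise. Let $g^*\in\mathbb R$ (optimal long-run average gain) and $h:\{0,\ldots,N\}\to\mathbb R$ (bias) solve the Bellman equations $g^*+h(n)=\max_{\lambda\in A_n}\{r_n(\lambda)+\sum_{j=0}^N\mathbf P(j|n,\lambda)h(j)\}$ for $n=0,\ldots,N$. The optimal arrival rate policy is $$\lambda_n^*=\inf\Big(\arg\max_{\lambda\in A_n}\Big\{r_n(\lambda)+\sum_{j=0}^N\mathbf P(j|n,\lambda)h(j)\Big\}\Big),\quad n=0,\ldots,N$$ (so $\lambda_N^*=0$). *)

theory Defs
  imports "HOL-Probability.Probability"
begin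

record queue =
  servers :: nat           (* m *)
  capacity :: nat          (* N *)
  max_rate :: real         (* Lambda *)
  service_rate :: real     (* mu *)
  abandon_service :: real  (* theta_s *)
  abandon_wait :: real     (* theta_q *)
  holding_cost :: real     (* c_h *)
  service_cost :: real     (* c_s, cost per abandonment in service *)
  wait_cost :: real        (* c_q, cost per abandonment while waiting *)
  val_min :: real          (* a *)
  val_max :: real          (* b *)
  val_cdf :: "real \<Rightarrow> real" (* F *)

text \<open>A continuous cumulative distribution function supported on \<open>[a,b]\<close> whose distribution has a
  density with respect to Lebesgue measure that is positive on \<open>[a,b]\<close>. Continuity and the boundary
  values follow from the existence of the density; they are listed because they are part of the
  standing assumptions.\<close>

definition cdf_with_positive_density :: "real \<Rightarrow> real \<Rightarrow> (real \<Rightarrow> real) \<Rightarrow> bool" where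
  "cdf_with_positive_density a b F \<longleftrightarrow>
     continuous_on UNIV F \<and> F a = 0 \<and> F b = 1 \<and>
     (\<exists>M f. real_distribution M \<and> F = cdf M \<and>
        f \<in> borel_measurable borel \<and> (\<forall>x\<in>{a..b}. f x > 0) \<and> (\<forall>x. x \<notin> {a..b} \<longrightarrow> f x = 0) \<and>
        M = density lborel (\<lambda>x. ennreal (f x)))"

definition inv_tail :: "queue \<Rightarrow> real \<Rightarrow> real" where
  "inv_tail Q y = Inf {x \<in> {val_min Q..val_max Q}. 1 - val_cdf Q x \<le> y}"

locale queue_model =
  fixes Q :: queue
  assumes servers_pos: "1 \<le> servers Q"
    and servers_le_capacity: "servers Q \<le> capacity Q"
    and max_rate_pos: "max_rate Q > 0"
    and service_rate_pos: "service_rate Q > 0"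
    and abandon_service_nonneg: "abandon_service Q \<ge> 0"
    and abandon_wait_pos: "abandon_wait Q > 0"
    and holding_cost_nonneg: "holding_cost Q \<ge> 0"
    and service_cost_nonneg: "service_cost Q \<ge> 0"
    and wait_cost_nonneg: "wait_cost Q \<ge> 0"
    and val_min_nonneg: "0 \<le> val_min Q"
    and val_min_less_max: "val_min Q < val_max Q"
    and val_cdf: "cdf_with_positive_density (val_min Q) (val_max Q) (val_cdf Q)"
    and time_unit: "max_rate Q + real (servers Q) * (service_rate Q + abandon_service Q)
      + (real (capacity Q) - real (servers Q)) * abandon_wait Q = 1"

definition death_rate :: "queue \<Rightarrow> nat \<Rightarrow> real" where
  "death_rate Q n =
     min (real n) (real (servers Q)) * (service_rate Q + abandon_service Q)
     + max (real n - real (servers Q)) 0 * abandon_wait Q"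

definition actions :: "queue \<Rightarrow> nat \<Rightarrow> real set" where
  "actions Q n = (if n < capacity Q then {0..max_rate Q} else {0})"

definition reward :: "queue \<Rightarrow> nat \<Rightarrow> real \<Rightarrow> real" where
  "reward Q n l =
     l * inv_tail Q (l / max_rate Q) - real n * holding_cost Q
     - min (real n) (real (servers Q)) * service_cost Q * abandon_service Q
     - max (real n - real (servers Q)) 0 * wait_cost Q * abandon_wait Q"

text \<open>\<open>trans_prob Q j n l\<close> is the probability of moving to state \<open>j\<close> from state \<open>n\<close> under
  action \<open>l\<close>.\<close>

definition trans_prob :: "queue \<Rightarrow> nat \<Rightarrow> nat \<Rightarrow> real \<Rightarrow> real" where
  "trans_prob Q j n l =
     (if n < capacity Q \<and> j = n + 1 then l
      else if n \<ge> 1 \<and> j = n - 1 then death_rate Q n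
      else if j = n then 1 - l - death_rate Q n
      else 0)"

definition action_value :: "queue \<Rightarrow> (nat \<Rightarrow> real) \<Rightarrow> nat \<Rightarrow> real \<Rightarrow> real" where
  "action_value Q h n l = reward Q n l + (\<Sum>j=0..capacity Q. trans_prob Q j n l * h j)"

text \<open>The maximum in the Bellman equation ranges over an infinite action set, so it is spelled out as
  the greatest element of the set of action values (in particular, it is attained).\<close>

definition bellman_solution :: "queue \<Rightarrow> real \<Rightarrow> (nat \<Rightarrow> real) \<Rightarrow> bool" where
  "bellman_solution Q g h \<longleftrightarrow>
     (\<forall>n\<le>capacity Q.
        g + h n \<in> action_value Q h n ` actions Q n \<and>
        (\<forall>l\<in>actions Q n. action_value Q h n l \<le> g + h n))"

definition opt_rate :: "queue \<Rightarrow> (nat \<Rightarrow> real) \<Rightarrow> nat \<Rightarrow> real" where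
  "opt_rate Q h n = Inf {l. is_arg_max (action_value Q h n) (\<lambda>l. l \<in> actions Q n) l}"

end

theory Submission
  imports Defs
begin

text \<open>
  Let \<open>\<Delta>\<^sub>n = h(n) - h(n + 1)\<close> be the marginal cost of admitting one more customer in state \<open>n\<close>.
  The admission decision trades revenue against this cost only: it maximizes
  \<open>R(\<lambda>) - \<lambda> \<Delta>\<^sub>n\<close> over \<open>[0, \<Lambda>]\<close>, where \<open>R(\<lambda>)\<close> is the revenue rate. Hence a larger
  \<open>\<Delta>\<^sub>n\<close> means a smaller optimal rate, and uni-modality of the rates amounts to \<open>\<Delta>\<close> being
  valley-shaped: nonincreasing first, then nondecreasing.

  Let \<open>\<Phi>\<^sub>n\<close> be the maximum of \<open>R(\<lambda>) - \<lambda> \<Delta>\<^sub>n\<close>; it is nonnegative because \<open>R(0) = 0\<close>,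
  does not increase with \<open>\<Delta>\<^sub>n\<close>,
  and \<open>\<Phi>\<^sub>N = 0\<close> because admission is forbidden in the full state. The Bellman equation reads
  \<open>\<Phi>\<^sub>n = g + C\<^sub>n - \<gamma>\<^sub>n \<Delta>\<^sub>n\<^sub>-\<^sub>1\<close> with \<open>C\<^sub>n\<close> the state cost. Differencing consecutive states removes \<open>g\<close>:
  \<open>\<Phi>\<^sub>n\<^sub>+\<^sub>1 - \<Phi>\<^sub>n = (c\<^sub>n - \<delta>\<^sub>n \<Delta>\<^sub>n) - \<gamma>\<^sub>n (\<Delta>\<^sub>n - \<Delta>\<^sub>n\<^sub>-\<^sub>1)\<close>,
  where \<open>c\<close> and \<open>\<delta> > 0\<close>, the increments of \<open>C\<close> and \<open>\<gamma>\<close>, are constant below \<open>m\<close> and constant from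
  \<open>m\<close> on. Each of the two blocks has its own reason why a rise of \<open>\<Delta>\<close> is followed by a rise.

  In the lower block (lemma \<open>rise_persists_from_first\<close>), \<open>\<Phi>\<close> does not
  increase at the first rise although the \<open>\<gamma>\<close>-term is nonnegative there, so \<open>c \<le> \<delta> \<Delta>\<close>. From then on both terms on the
  right are negative and \<open>\<Delta>\<close> keeps rising.

  At \<open>m\<close> the sign of \<open>c - \<delta> \<Delta>\<close> may flip, so this argument does not cross the boundary. In the upper
  block (lemma \<open>rise_persists_to_end\<close>) the end condition is used: a rise of \<open>\<Delta>\<close> not followed by
  a rise would force \<open>c > \<delta> \<Delta>\<close> from there on (lemma \<open>no_fall_with_positive_drift\<close>), and then \<open>\<Phi>\<close> would increase strictly all the way to \<open>N\<close>,
  which contradicts \<open>\<Phi>\<^sub>N = 0\<close>.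
\<close>

section \<open>Valley-shaped solutions of the differenced Bellman equation\<close>

text \<open>At \<open>n = 0\<close> the truncated subtraction gives \<open>d (n - 1) = d n\<close>, which makes the last term vanish,
  as it should since no customer can leave an empty system.\<close>

lemma rise_persists_from_first:
  fixes d \<Phi> \<gamma> :: "nat \<Rightarrow> real"
  assumes bal: "\<And>n. n < m \<Longrightarrow> n < N \<Longrightarrow>
      \<Phi> (Suc n) - \<Phi> n = c - \<delta> * d n - \<gamma> n * (d n - d (n - 1))"
    and anti: "\<And>i j. i < N \<Longrightarrow> j < N \<Longrightarrow> d i \<le> d j \<Longrightarrow> \<Phi> j \<le> \<Phi> i"
    and \<gamma>: "\<And>n. \<gamma> n \<ge> 0" and \<delta>: "\<delta> > 0"
    and first: "\<And>j. j < k \<Longrightarrow> d j \<le> d (j - 1)" and rise: "d (k - 1) < d k"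
    and j: "k \<le> j" "j \<le> m" "j < N"
  shows "d (j - 1) < d j \<and> c < \<delta> * d j"
  using j
proof (induction j rule: dec_induct)
  case base
  have k: "k > 0" using rise by (cases k) auto
  have "\<Phi> k \<le> \<Phi> (k - 1)"
    using anti[of "k - 1" k] rise base by simp
  moreover have "\<Phi> k - \<Phi> (k - 1) = c - \<delta> * d (k - 1) - \<gamma> (k - 1) * (d (k - 1) - d (k - 1 - 1))"
    using bal[of "k - 1"] k base by simp
  moreover have "\<gamma> (k - 1) * (d (k - 1) - d (k - 1 - 1)) \<le> 0"
    using \<gamma>[of "k - 1"] first[of "k - 1"] k by (simp add: mult_nonneg_nonpos)
  ultimately have "c \<le> \<delta> * d (k - 1)" by linarith
  also have "\<dots> < \<delta> * d k" using \<delta> rise by simp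
  finally show ?case using rise by simp
next
  case (step j)
  then have IH: "d (j - 1) < d j" "c < \<delta> * d j" and "j < m" "Suc j < N" by auto
  have "\<gamma> j * (d j - d (j - 1)) \<ge> 0" using \<gamma> IH by simp
  then have "\<Phi> (Suc j) < \<Phi> j" using bal[of j] IH \<open>j < m\<close> \<open>Suc j < N\<close> by simp
  then have up: "d j < d (Suc j)"
    using anti[of "Suc j" j] \<open>Suc j < N\<close> by fastforce
  then have "\<delta> * d j < \<delta> * d (Suc j)" using \<delta> by simp
  then show ?case using up IH by simp
qed

text \<open>The end condition excludes any state from which \<open>\<Phi>\<close> is bound to increase: once \<open>d\<close> does not
  rise and \<open>c > \<delta> d\<close>, both properties are inherited by the next state, so \<open>\<Phi>\<close>, which is
  nonnegative, would reach \<open>N\<close> with a positive value.\<close>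

lemma no_fall_with_positive_drift:
  fixes d \<Phi> \<gamma> :: "nat \<Rightarrow> real"
  assumes bal: "\<And>n. m \<le> n \<Longrightarrow> n < N \<Longrightarrow>
      \<Phi> (Suc n) - \<Phi> n = c - \<delta> * d n - \<gamma> n * (d n - d (n - 1))"
    and anti: "\<And>i j. i < N \<Longrightarrow> j < N \<Longrightarrow> d i \<le> d j \<Longrightarrow> \<Phi> j \<le> \<Phi> i"
    and \<gamma>: "\<And>n. \<gamma> n \<ge> 0" and \<delta>: "\<delta> > 0"
    and nonneg: "\<And>n. n < N \<Longrightarrow> \<Phi> n \<ge> 0" and final: "\<Phi> N = 0"
    and n: "m \<le> n" "n < N" "d n \<le> d (n - 1)" "\<delta> * d n < c"
  shows False
proof -
  have grow: "\<Phi> j < \<Phi> (Suc j)"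
    if "m \<le> j" "j < N" "d j \<le> d (j - 1)" "\<delta> * d j < c" for j
  proof -
    have "\<gamma> j * (d j - d (j - 1)) \<le> 0"
      using \<gamma> that by (simp add: mult_nonneg_nonpos)
    then show ?thesis using bal[of j] that by simp
  qed
  have down: "d j \<le> d (j - 1) \<and> \<delta> * d j < c" if "n \<le> j" "j < N" for j
    using that
  proof (induction j rule: dec_induct)
    case base
    then show ?case using n by simp
  next
    case (step j)
    then have IH: "d j \<le> d (j - 1)" "\<delta> * d j < c" by auto
    have "\<Phi> j < \<Phi> (Suc j)" using grow[of j] IH step n by simp
    then have fall: "d (Suc j) < d j"
      using anti[of j "Suc j"] step by fastforce
    then have "\<delta> * d (Suc j) < \<delta> * d j" using \<delta> by simp
    then show ?case using fall IH by simp
  qed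
  have last: "n \<le> N - 1" "N - 1 < N" "m \<le> N - 1" "Suc (N - 1) = N" using n by auto
  have "\<Phi> (N - 1) < \<Phi> N"
    using grow[of "N - 1"] down[of "N - 1"] last by simp
  then show False using nonneg[of "N - 1"] final last by simp
qed

lemma rise_persists_to_end:
  fixes d \<Phi> \<gamma> :: "nat \<Rightarrow> real"
  assumes bal: "\<And>n. m \<le> n \<Longrightarrow> n < N \<Longrightarrow>
      \<Phi> (Suc n) - \<Phi> n = c - \<delta> * d n - \<gamma> n * (d n - d (n - 1))"
    and anti: "\<And>i j. i < N \<Longrightarrow> j < N \<Longrightarrow> d i \<le> d j \<Longrightarrow> \<Phi> j \<le> \<Phi> i"
    and \<gamma>: "\<And>n. m \<le> n \<Longrightarrow> \<gamma> n > 0" "\<And>n. \<gamma> n \<ge> 0" and \<delta>: "\<delta> > 0"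
    and nonneg: "\<And>n. n < N \<Longrightarrow> \<Phi> n \<ge> 0" and final: "\<Phi> N = 0"
    and n: "m \<le> n" "Suc n < N" "d (n - 1) < d n"
  shows "d n < d (Suc n)"
proof (rule ccontr)
  assume "\<not> d n < d (Suc n)"
  then have fall: "d (Suc n) \<le> d n" by simp
  then have "\<Phi> n \<le> \<Phi> (Suc n)" using anti n by simp
  moreover have "\<gamma> n * (d n - d (n - 1)) > 0" using \<gamma> n by simp
  ultimately have "\<delta> * d n < c" using bal[of n] n by simp
  moreover have "\<delta> * d (Suc n) \<le> \<delta> * d n" using fall \<delta> by simp
  ultimately have "\<delta> * d (Suc n) < c" by linarith
  then show False
    using no_fall_with_positive_drift[of m N \<Phi> c \<delta> d \<gamma> "Suc n"] bal anti \<gamma> \<delta> nonneg final n fall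
    by simp
qed

lemma valley_shape:
  fixes d \<Phi> \<gamma> :: "nat \<Rightarrow> real"
  assumes N: "0 < N"
    and bal\<^sub>1: "\<And>n. n < m \<Longrightarrow> n < N \<Longrightarrow>
      \<Phi> (Suc n) - \<Phi> n = c\<^sub>1 - \<delta>\<^sub>1 * d n - \<gamma> n * (d n - d (n - 1))"
    and bal\<^sub>2: "\<And>n. m \<le> n \<Longrightarrow> n < N \<Longrightarrow>
      \<Phi> (Suc n) - \<Phi> n = c\<^sub>2 - \<delta>\<^sub>2 * d n - \<gamma> n * (d n - d (n - 1))"
    and anti: "\<And>i j. i < N \<Longrightarrow> j < N \<Longrightarrow> d i \<le> d j \<Longrightarrow> \<Phi> j \<le> \<Phi> i"
    and \<gamma>: "\<And>n. m \<le> n \<Longrightarrow> \<gamma> n > 0" "\<And>n. \<gamma> n \<ge> 0" and \<delta>: "\<delta>\<^sub>1 > 0" "\<delta>\<^sub>2 > 0"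
    and nonneg: "\<And>n. n < N \<Longrightarrow> \<Phi> n \<ge> 0" and final: "\<Phi> N = 0"
  obtains k where "k < N" "\<And>n. n < k \<Longrightarrow> d (Suc n) \<le> d n"
    "\<And>n. k \<le> n \<Longrightarrow> Suc n < N \<Longrightarrow> d n \<le> d (Suc n)"
proof (cases "\<exists>k<N. d (k - 1) < d k")
  case False
  show thesis
  proof (rule that[of "N - 1"])
    fix n assume "n < N - 1"
    then show "d (Suc n) \<le> d n" using False by (auto dest!: spec[of _ "Suc n"])
  qed (use N in auto)
next
  case True
  define k where "k = (LEAST k. k < N \<and> d (k - 1) < d k)"
  have k: "k < N" "d (k - 1) < d k"
    using LeastI_ex[OF True[unfolded Bex_def]] unfolding k_def by auto
  have first: "d j \<le> d (j - 1)" if "j < k" for j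
    using not_less_Least[of j "\<lambda>k. k < N \<and> d (k - 1) < d k"] that k(1)
    unfolding k_def[symmetric] by simp
  have k0: "k > 0" using k(2) by (cases k) auto
  have rise: "d (j - 1) < d j" if "k \<le> j" "j < N" for j
    using that
  proof (induction j rule: dec_induct)
    case base
    then show ?case using k by simp
  next
    case (step j)
    show ?case
    proof (cases "j < m")
      case True
      then show ?thesis
        using rise_persists_from_first[of m N \<Phi> c\<^sub>1 \<delta>\<^sub>1 d \<gamma> k "Suc j"]
          bal\<^sub>1 anti \<gamma> \<delta> first k step by simp
    next
      case False
      then show ?thesis
        using rise_persists_to_end[of m N \<Phi> c\<^sub>2 \<delta>\<^sub>2 d \<gamma> j]
          bal\<^sub>2 anti \<gamma> \<delta> nonneg final step by simp
    qed
  qed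
  show thesis
  proof (rule that[of "k - 1"])
    show "k - 1 < N" using k by simp
    show "d (Suc n) \<le> d n" if "n < k - 1" for n
      using first[of "Suc n"] that by simp
    show "d n \<le> d (Suc n)" if "k - 1 \<le> n" "Suc n < N" for n
      using rise[of "Suc n"] that k0 by force
  qed
qed

section \<open>Admission decisions in terms of the marginal cost\<close>

definition admission_surplus :: "queue \<Rightarrow> real \<Rightarrow> real \<Rightarrow> real" where
  "admission_surplus Q x l = l * inv_tail Q (l / max_rate Q) - l * x"

definition state_cost :: "queue \<Rightarrow> nat \<Rightarrow> real" where
  "state_cost Q n = real n * holding_cost Q
     + min (real n) (real (servers Q)) * service_cost Q * abandon_service Q
     + max (real n - real (servers Q)) 0 * wait_cost Q * abandon_wait Q"

text \<open>In the full state the equation reads \<open>h\<close> beyond the capacity, where the factor \<open>l = 0\<close>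
  removes it; likewise the vanishing death rate covers \<open>h (n - 1)\<close> at \<open>n = 0\<close>.\<close>

lemma action_value_eq:
  assumes "n \<le> capacity Q" "l \<in> actions Q n"
  shows "action_value Q h n l = admission_surplus Q (h n - h (Suc n)) l - state_cost Q n
    + h n - death_rate Q n * (h n - h (n - 1))"
proof -
  have split: "trans_prob Q j n l * h j =
      (if j = n then (1 - l - death_rate Q n) * h n else 0)
      + (if j = Suc n then (if n < capacity Q then l * h (Suc n) else 0) else 0)
      + (if j = n - 1 then (if n \<ge> 1 then death_rate Q n * h (n - 1) else 0) else 0)" for j
    unfolding trans_prob_def by auto
  have zero: "death_rate Q 0 = 0" by (simp add: death_rate_def)
  have full: "l = 0" if "\<not> n < capacity Q" using that assms by (auto simp: actions_def)
  have "(\<Sum>j=0..capacity Q. trans_prob Q j n l * h j) =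
      (1 - l - death_rate Q n) * h n + l * h (Suc n) + death_rate Q n * h (n - 1)"
    unfolding split sum.distrib using assms full zero
    by (cases n; cases "n < capacity Q") (auto simp: sum.delta)
  then show ?thesis
    unfolding action_value_def reward_def admission_surplus_def state_cost_def
    by (simp add: algebra_simps)
qed

text \<open>The set of maximizers of the surplus moves to the left as the marginal cost grows: comparing a
  maximizer at \<open>x\<close> with one at \<open>y > x\<close> in both problems and adding the two inequalities leaves
  \<open>(y - x) (l - l') \<ge> 0\<close>.\<close>

lemma surplus_maximizer_antimono:
  assumes "x < y" "l \<in> S" "l' \<in> S"
    and "\<And>s. s \<in> S \<Longrightarrow> admission_surplus Q x s \<le> admission_surplus Q x l"
    and "\<And>s. s \<in> S \<Longrightarrow> admission_surplus Q y s \<le> admission_surplus Q y l'"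
  shows "l' \<le> l"
proof -
  have "admission_surplus Q x l' \<le> admission_surplus Q x l"
    "admission_surplus Q y l \<le> admission_surplus Q y l'"
    using assms by auto
  then have "(y - x) * (l - l') \<ge> 0"
    unfolding admission_surplus_def by (simp add: algebra_simps)
  then show ?thesis using assms(1) by (simp add: zero_le_mult_iff)
qed

lemma opt_rate_eq_Inf_surplus_maximizers:
  assumes "n \<le> capacity Q"
  shows "opt_rate Q h n = Inf {l \<in> actions Q n. \<forall>s\<in>actions Q n.
    admission_surplus Q (h n - h (Suc n)) s \<le> admission_surplus Q (h n - h (Suc n)) l}"
proof -
  have "is_arg_max (action_value Q h n) (\<lambda>l. l \<in> actions Q n) l \<longleftrightarrow>
      l \<in> actions Q n \<and> (\<forall>s\<in>actions Q n.
        admission_surplus Q (h n - h (Suc n)) s \<le> admission_surplus Q (h n - h (Suc n)) l)" for l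
    unfolding is_arg_max_linorder using action_value_eq[OF assms, of _ h] by auto
  then show ?thesis unfolding opt_rate_def by (intro arg_cong[of _ _ Inf] Collect_cong)
qed

section \<open>Solutions of the Bellman equations\<close>

text \<open>The largest admission surplus in state \<open>n\<close>, as it is determined by the Bellman equation: this
  form does not mention the maximization, so that it can be differenced in \<open>n\<close>.\<close>

definition bellman_surplus :: "queue \<Rightarrow> real \<Rightarrow> (nat \<Rightarrow> real) \<Rightarrow> nat \<Rightarrow> real" where
  "bellman_surplus Q g h n = g + state_cost Q n + death_rate Q n * (h n - h (n - 1))"

lemma bellman_surplus_maximal:
  assumes "bellman_solution Q g h" "n \<le> capacity Q"
  shows "\<exists>l\<in>actions Q n. admission_surplus Q (h n - h (Suc n)) l = bellman_surplus Q g h n"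
    and "l \<in> actions Q n \<Longrightarrow>
      admission_surplus Q (h n - h (Suc n)) l \<le> bellman_surplus Q g h n"
proof -
  have att: "g + h n \<in> action_value Q h n ` actions Q n"
    and le: "\<And>l. l \<in> actions Q n \<Longrightarrow> action_value Q h n l \<le> g + h n"
    using assms unfolding bellman_solution_def by auto
  from att obtain s where s: "s \<in> actions Q n" "g + h n = action_value Q h n s" by auto
  show "\<exists>l\<in>actions Q n. admission_surplus Q (h n - h (Suc n)) l = bellman_surplus Q g h n"
    using s action_value_eq[OF assms(2) s(1), of h]
    by (intro bexI[of _ s]) (auto simp: bellman_surplus_def)
  show "admission_surplus Q (h n - h (Suc n)) l \<le> bellman_surplus Q g h n"
    if "l \<in> actions Q n"
    using le[OF that] action_value_eq[OF assms(2) that, of h] by (simp add: bellman_surplus_def)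
qed

lemma bellman_surplus_full:
  assumes "bellman_solution Q g h"
  shows "bellman_surplus Q g h (capacity Q) = 0"
  using bellman_surplus_maximal(1)[OF assms order_refl]
  by (auto simp: actions_def admission_surplus_def)

lemma state_cost_Suc:
  "state_cost Q (Suc n) = state_cost Q n + holding_cost Q
    + (if n < servers Q then service_cost Q * abandon_service Q else wait_cost Q * abandon_wait Q)"
  by (auto simp: state_cost_def min_def max_def algebra_simps)

lemma death_rate_Suc:
  "death_rate Q (Suc n) = death_rate Q n
    + (if n < servers Q then service_rate Q + abandon_service Q else abandon_wait Q)"
  by (auto simp: death_rate_def min_def max_def algebra_simps)

lemma bellman_surplus_Suc:
  "bellman_surplus Q g h (Suc n) - bellman_surplus Q g h n =
    (state_cost Q (Suc n) - state_cost Q n)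
    - (death_rate Q (Suc n) - death_rate Q n) * (h n - h (Suc n))
    - death_rate Q n * ((h n - h (Suc n)) - (h (n - 1) - h (Suc (n - 1))))"
  by (cases n) (simp_all add: bellman_surplus_def death_rate_def algebra_simps)

context queue_model
begin

lemma death_rate_nonneg: "death_rate Q n \<ge> 0"
  unfolding death_rate_def using service_rate_pos abandon_service_nonneg abandon_wait_pos by simp

lemma death_rate_pos:
  assumes "servers Q \<le> n"
  shows "death_rate Q n > 0"
proof -
  have "min (real n) (real (servers Q)) * (service_rate Q + abandon_service Q) > 0"
    using assms servers_pos service_rate_pos abandon_service_nonneg by simp
  moreover have "max (real n - real (servers Q)) 0 * abandon_wait Q \<ge> 0"
    using abandon_wait_pos by simp
  ultimately show ?thesis unfolding death_rate_def by linarith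
qed

lemma bellman_surplus_nonneg:
  assumes "bellman_solution Q g h" "n < capacity Q"
  shows "bellman_surplus Q g h n \<ge> 0"
  using bellman_surplus_maximal(2)[OF assms(1), of n 0] assms(2) max_rate_pos
  by (simp add: actions_def admission_surplus_def)

text \<open>A rate that is optimal at the larger marginal cost earns at least as much at the smaller one.\<close>

lemma bellman_surplus_antimono:
  assumes sol: "bellman_solution Q g h" and ij: "i < capacity Q" "j < capacity Q"
    and le: "h i - h (Suc i) \<le> h j - h (Suc j)"
  shows "bellman_surplus Q g h j \<le> bellman_surplus Q g h i"
proof -
  obtain l where l: "l \<in> actions Q j"
    "admission_surplus Q (h j - h (Suc j)) l = bellman_surplus Q g h j"
    using bellman_surplus_maximal(1)[OF sol, of j] ij by auto
  have "admission_surplus Q (h j - h (Suc j)) l \<le> admission_surplus Q (h i - h (Suc i)) l"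
    using l(1) ij le by (auto simp: actions_def admission_surplus_def intro!: mult_left_mono)
  also have "\<dots> \<le> bellman_surplus Q g h i"
    using bellman_surplus_maximal(2)[OF sol, of i l] l(1) ij by (simp add: actions_def)
  finally show ?thesis using l by simp
qed

lemma surplus_maximizers_nonempty:
  assumes "bellman_solution Q g h" "n \<le> capacity Q"
  shows "{l \<in> actions Q n. \<forall>s\<in>actions Q n.
    admission_surplus Q (h n - h (Suc n)) s \<le> admission_surplus Q (h n - h (Suc n)) l} \<noteq> {}"
proof -
  obtain l where "l \<in> actions Q n"
    "admission_surplus Q (h n - h (Suc n)) l = bellman_surplus Q g h n"
    using bellman_surplus_maximal(1)[OF assms] by auto
  then show ?thesis using bellman_surplus_maximal(2)[OF assms] by auto
qed

lemma opt_rate_antimono: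
  assumes sol: "bellman_solution Q g h" and ij: "i < capacity Q" "j < capacity Q"
    and le: "h i - h (Suc i) \<le> h j - h (Suc j)"
  shows "opt_rate Q h j \<le> opt_rate Q h i"
proof -
  define S where "S x = {l \<in> {0..max_rate Q}. \<forall>s\<in>{0..max_rate Q}.
    admission_surplus Q x s \<le> admission_surplus Q x l}" for x
  have opt: "opt_rate Q h n = Inf (S (h n - h (Suc n)))" "S (h n - h (Suc n)) \<noteq> {}"
    if "n < capacity Q" for n
    using that opt_rate_eq_Inf_surplus_maximizers[of n Q h]
      surplus_maximizers_nonempty[OF sol, of n]
    by (simp_all add: actions_def S_def)
  have bdd: "bdd_below (S x)" for x
    by (rule bdd_belowI[of _ 0]) (auto simp: S_def)
  show ?thesis
  proof (cases "h i - h (Suc i) = h j - h (Suc j)")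
    case True
    then show ?thesis using opt ij by simp
  next
    case False
    then have less: "h i - h (Suc i) < h j - h (Suc j)" using le by simp
    have sep: "l' \<le> l" if "l \<in> S (h i - h (Suc i))" "l' \<in> S (h j - h (Suc j))" for l l'
      using surplus_maximizer_antimono[OF less, of l "{0..max_rate Q}" l' Q] that
      by (auto simp: S_def)
    obtain l' where l': "l' \<in> S (h j - h (Suc j))" using opt(2)[OF ij(2)] by auto
    have "Inf (S (h j - h (Suc j))) \<le> l'" using l' bdd by (rule cInf_lower)
    also have "\<dots> \<le> Inf (S (h i - h (Suc i)))"
      using opt(2)[OF ij(1)] sep l' by (intro cInf_greatest) auto
    finally show ?thesis using opt(1) ij by simp
  qed
qed

lemma opt_rate_nonneg:
  assumes "bellman_solution Q g h" "n \<le> capacity Q"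
  shows "opt_rate Q h n \<ge> 0"
  unfolding opt_rate_eq_Inf_surplus_maximizers[OF assms(2)]
  using surplus_maximizers_nonempty[OF assms]
  by (intro cInf_greatest) (auto simp: actions_def split: if_splits)

lemma opt_rate_full: "opt_rate Q h (capacity Q) = 0"
proof -
  have "opt_rate Q h (capacity Q) = Inf {0::real}"
    unfolding opt_rate_eq_Inf_surplus_maximizers[OF order_refl]
    by (rule arg_cong[of _ _ Inf]) (auto simp: actions_def)
  then show ?thesis by simp
qed

lemma marginal_cost_valley_shape:
  assumes "bellman_solution Q g h"
  obtains k where "k < capacity Q"
    "\<And>n. n < k \<Longrightarrow> h (Suc n) - h (Suc (Suc n)) \<le> h n - h (Suc n)"
    "\<And>n. k \<le> n \<Longrightarrow> Suc n < capacity Q \<Longrightarrow> h n - h (Suc n) \<le> h (Suc n) - h (Suc (Suc n))"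
proof (rule valley_shape[where d = "\<lambda>n. h n - h (Suc n)" and \<Phi> = "bellman_surplus Q g h"
      and \<gamma> = "death_rate Q" and m = "servers Q" and N = "capacity Q"
      and \<delta>\<^sub>1 = "service_rate Q + abandon_service Q" and \<delta>\<^sub>2 = "abandon_wait Q"
      and c\<^sub>1 = "holding_cost Q + service_cost Q * abandon_service Q"
      and c\<^sub>2 = "holding_cost Q + wait_cost Q * abandon_wait Q"])
  show "0 < capacity Q" using servers_pos servers_le_capacity by simp
  show "0 < service_rate Q + abandon_service Q" "0 < abandon_wait Q"
    using service_rate_pos abandon_service_nonneg abandon_wait_pos by simp_all
qed (use assms that in \<open>simp_all add: bellman_surplus_Suc state_cost_Suc death_rate_Suc
      bellman_surplus_antimono bellman_surplus_nonneg bellman_surplus_full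
      death_rate_nonneg death_rate_pos\<close>)

end

theorem theorem4p1:
  fixes Q :: queue and g :: real and h :: "nat \<Rightarrow> real"
  assumes "queue_model Q"
    and "bellman_solution Q g h"
  shows "\<exists>k\<in>{0..capacity Q - 1}.
    (\<forall>n. 0 \<le> n \<and> n < k \<longrightarrow> opt_rate Q h n \<le> opt_rate Q h (n + 1)) \<and>
    (\<forall>n. k \<le> n \<and> n < capacity Q \<longrightarrow> opt_rate Q h n \<ge> opt_rate Q h (n + 1))"
proof -
  interpret queue_model Q by fact
  obtain k where k: "k < capacity Q"
    "\<And>n. n < k \<Longrightarrow> h (Suc n) - h (Suc (Suc n)) \<le> h n - h (Suc n)"
    "\<And>n. k \<le> n \<Longrightarrow> Suc n < capacity Q \<Longrightarrow> h n - h (Suc n) \<le> h (Suc n) - h (Suc (Suc n))"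
    using marginal_cost_valley_shape[OF assms(2)] by blast
  have "opt_rate Q h n \<le> opt_rate Q h (n + 1)" if "n < k" for n
    using opt_rate_antimono[OF assms(2), of "Suc n" n] k(1) k(2)[OF that] that by simp
  moreover have "opt_rate Q h n \<ge> opt_rate Q h (n + 1)" if "k \<le> n" "n < capacity Q" for n
  proof (cases "Suc n < capacity Q")
    case True
    then show ?thesis using opt_rate_antimono[OF assms(2), of n "Suc n"] k(3) that by simp
  next
    case False
    then have "n + 1 = capacity Q" using that by simp
    then show ?thesis using opt_rate_full opt_rate_nonneg[OF assms(2), of n] that by simp
  qed
  ultimately show ?thesis using k(1) by (intro bexI[of _ k]) auto
qed

end
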